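(* Let $\mathbb{T}$ be a semi-abelian theory. If $A$ is a topological $\mathbb{T}$-algebra, then the fundamental groupoid $\pi A$, with object set the $\mathbb{T}$-algebra $A$ and with operations on arrows $\tau([\beta_1],\dots,[\beta_n])=[\tau(\beta_1,\dots,\beta_n)]$, is an internal groupoid in the semi-abelian category $\mathsf{Set}^{\mathbb{T}}$ of $\mathbb{T}$-algebras.
   Context: An algebraic theory (in the sense of Lawvere) $\mathbb{T}$ is a category with objects $T^0,T,T^2,T^3,\dots$, where $T^n$ is the $n$-fold product of a distinguished object $T$ with itself, with chosen projections. Morphisms $T^n\to T$ are called $n$-ary operations; $0$-ary operations are called constants. A $\mathbb{T}$-algebra is a product-preserving functor $\mathbb{T}\to\mathsf{Set}$; equivalently, a set $A$ with a map $\tau=\tau_A\colon A^n\to A$ for each $n$-ary operation $\tau$, compatible with composition and projections in $\mathbb{T}$. A $\mathbb{T}$-homomorphism is a map commuting with all operations. The category of $\mathbb{T}$-algebras is $\mathsf{Set}^{\mathbb{T}}$. The theory $\mathbb{T}$ is called semi-abelian if $\mathsf{Set}^{\mathbb{T}}$ is a semi-abelian category (Barr-exact, protomodular, with finite coproducts and a zero object); equivalently (Bourn--Janelidze), $\mathbb{T}$ has a unique constant $e$ and, for some natural number $n$, has binary operations $\alpha_1,\dots,\alpha_n$ with $\alpha_i(X,X)=e$ and an $(n+1)$-ary operation $\theta$ with $\theta(\alpha_1(X,Y),\dots,\alpha_n(X,Y),Y)=X$. A topological $\mathbb{T}$-algebra is a topological space $A$ with a $\mathbb{T}$-algebra structure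 such that every operation $\tau_A\colon A^n\to A$ is continuous. The fundamental groupoid $\pi A$ has the points of $A$ as objects; its arrows from $x$ to $y$ are homotopy classes $[\beta]$ relative to end points of paths from $x$ to $y$, composed by concatenation. For paths $\beta_1,\dots,\beta_n$ in $A$, $\tau(\beta_1,\dots,\beta_n)$ is the path $t\mapsto\tau(\beta_1(t),\dots,\beta_n(t))$. An internal groupoid in $\mathsf{Set}^{\mathbb{T}}$ is a groupoid $G$ (the arrow set also denoted $G$) such that the set of objects $\mathsf{Ob}(G)$ and the set of arrows $G$ are $\mathbb{T}$-algebras and the source and target maps $s,t\colon G\to\mathsf{Ob}(G)$, the identity map $\epsilon\colon\mathsf{Ob}(G)\to G$, the partial composition $G_t\times_s G\to G$, $(g,h)\mapsto g\circ h$ (defined when $t(g)=s(h)$), and the inversion $g\mapsto g^{-1}$ are all $\mathbb{T}$-homomorphisms. *)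

theory Defs
  imports "HOL-Analysis.Analysis"
begin

section \<open>Categories\<close>

record ('c, 'm) cat =
  Obj :: "'c set"
  Arr :: "'m set"
  Dom :: "'m \<Rightarrow> 'c"
  Cod :: "'m \<Rightarrow> 'c"
  Ident :: "'c \<Rightarrow> 'm"
  Comp :: "'m \<Rightarrow> 'm \<Rightarrow> 'm"  (infixl \<open>\<Zsemi>\<index>\<close> 70)

text \<open>Composition is written in diagrammatic order throughout: \<open>f \<Zsemi> g\<close> is first \<open>f\<close>, then \<open>g\<close>,
  and is meaningful when \<open>Cod f = Dom g\<close>.\<close>

definition Hom :: "('c, 'm, 'z) cat_scheme \<Rightarrow> 'c \<Rightarrow> 'c \<Rightarrow> 'm set" where
  "Hom C a b = {f \<in> Arr C. Dom C f = a \<and> Cod C f = b}"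

locale category =
  fixes C :: "('c, 'm, 'z) cat_scheme" (structure)
  assumes Dom_in: "f \<in> Arr C \<Longrightarrow> Dom C f \<in> Obj C"
    and Cod_in: "f \<in> Arr C \<Longrightarrow> Cod C f \<in> Obj C"
    and Ident_in: "a \<in> Obj C \<Longrightarrow> Ident C a \<in> Hom C a a"
    and Comp_in: "\<lbrakk>f \<in> Hom C a b; g \<in> Hom C b c\<rbrakk> \<Longrightarrow> f \<Zsemi> g \<in> Hom C a c"
    and Ident_left: "f \<in> Hom C a b \<Longrightarrow> Ident C a \<Zsemi> f = f"
    and Ident_right: "f \<in> Hom C a b \<Longrightarrow> f \<Zsemi> Ident C b = f"
    and Comp_assoc: "\<lbrakk>f \<in> Hom C a b; g \<in> Hom C b c; h \<in> Hom C c d\<rbrakk>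
      \<Longrightarrow> (f \<Zsemi> g) \<Zsemi> h = f \<Zsemi> (g \<Zsemi> h)"

definition is_iso :: "('c, 'm, 'z) cat_scheme \<Rightarrow> 'm \<Rightarrow> bool" where
  "is_iso C f \<longleftrightarrow> f \<in> Arr C \<and>
     (\<exists>g \<in> Hom C (Cod C f) (Dom C f).
        f \<Zsemi>\<^bsub>C\<^esub> g = Ident C (Dom C f) \<and> g \<Zsemi>\<^bsub>C\<^esub> f = Ident C (Cod C f))"

definition is_terminal :: "('c, 'm, 'z) cat_scheme \<Rightarrow> 'c \<Rightarrow> bool" where
  "is_terminal C t \<longleftrightarrow> t \<in> Obj C \<and> (\<forall>a \<in> Obj C. \<exists>!f. f \<in> Hom C a t)"

definition is_initial :: "('c, 'm, 'z) cat_scheme \<Rightarrow> 'c \<Rightarrow> bool" where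
  "is_initial C i \<longleftrightarrow> i \<in> Obj C \<and> (\<forall>a \<in> Obj C. \<exists>!f. f \<in> Hom C i a)"

definition has_zero_object :: "('c, 'm, 'z) cat_scheme \<Rightarrow> bool" where
  "has_zero_object C \<longleftrightarrow> (\<exists>z. is_initial C z \<and> is_terminal C z)"

definition is_coproduct :: "('c, 'm, 'z) cat_scheme \<Rightarrow> 'c \<Rightarrow> 'c \<Rightarrow> 'c \<Rightarrow> 'm \<Rightarrow> 'm \<Rightarrow> bool" where
  "is_coproduct C a b s i j \<longleftrightarrow> i \<in> Hom C a s \<and> j \<in> Hom C b s \<and>
     (\<forall>z. \<forall>f \<in> Hom C a z. \<forall>g \<in> Hom C b z.
        \<exists>!h. h \<in> Hom C s z \<and> i \<Zsemi>\<^bsub>C\<^esub> h = f \<and> j \<Zsemi>\<^bsub>C\<^esub> h = g)"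

definition has_finite_coproducts :: "('c, 'm, 'z) cat_scheme \<Rightarrow> bool" where
  "has_finite_coproducts C \<longleftrightarrow> (\<exists>i. is_initial C i) \<and>
     (\<forall>a \<in> Obj C. \<forall>b \<in> Obj C. \<exists>s i j. is_coproduct C a b s i j)"

text \<open>\<open>is_pullback C p q f g\<close>: the span \<open>p, q\<close> is a pullback of the cospan \<open>f, g\<close>,
  with \<open>p \<Zsemi> f = q \<Zsemi> g\<close>.\<close>

definition is_pullback :: "('c, 'm, 'z) cat_scheme \<Rightarrow> 'm \<Rightarrow> 'm \<Rightarrow> 'm \<Rightarrow> 'm \<Rightarrow> bool" where
  "is_pullback C p q f g \<longleftrightarrow>
     f \<in> Arr C \<and> g \<in> Arr C \<and> Cod C f = Cod C g \<and>
     p \<in> Hom C (Dom C p) (Dom C f) \<and> q \<in> Hom C (Dom C p) (Dom C g) \<and>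
     p \<Zsemi>\<^bsub>C\<^esub> f = q \<Zsemi>\<^bsub>C\<^esub> g \<and>
     (\<forall>z. \<forall>a \<in> Hom C z (Dom C f). \<forall>b \<in> Hom C z (Dom C g).
        a \<Zsemi>\<^bsub>C\<^esub> f = b \<Zsemi>\<^bsub>C\<^esub> g \<longrightarrow>
        (\<exists>!h. h \<in> Hom C z (Dom C p) \<and> h \<Zsemi>\<^bsub>C\<^esub> p = a \<and> h \<Zsemi>\<^bsub>C\<^esub> q = b))"

definition has_pullbacks :: "('c, 'm, 'z) cat_scheme \<Rightarrow> bool" where
  "has_pullbacks C \<longleftrightarrow>
     (\<forall>f \<in> Arr C. \<forall>g \<in> Arr C. Cod C f = Cod C g \<longrightarrow> (\<exists>p q. is_pullback C p q f g))"

definition has_finite_limits :: "('c, 'm, 'z) cat_scheme \<Rightarrow> bool" where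
  "has_finite_limits C \<longleftrightarrow> (\<exists>t. is_terminal C t) \<and> has_pullbacks C"

definition is_coequalizer :: "('c, 'm, 'z) cat_scheme \<Rightarrow> 'm \<Rightarrow> 'm \<Rightarrow> 'm \<Rightarrow> bool" where
  "is_coequalizer C f g q \<longleftrightarrow>
     f \<in> Arr C \<and> g \<in> Hom C (Dom C f) (Cod C f) \<and> q \<in> Hom C (Cod C f) (Cod C q) \<and>
     f \<Zsemi>\<^bsub>C\<^esub> q = g \<Zsemi>\<^bsub>C\<^esub> q \<and>
     (\<forall>z. \<forall>k \<in> Hom C (Cod C f) z. f \<Zsemi>\<^bsub>C\<^esub> k = g \<Zsemi>\<^bsub>C\<^esub> k \<longrightarrow>
        (\<exists>!h. h \<in> Hom C (Cod C q) z \<and> q \<Zsemi>\<^bsub>C\<^esub> h = k))"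

definition is_regular_epi :: "('c, 'm, 'z) cat_scheme \<Rightarrow> 'm \<Rightarrow> bool" where
  "is_regular_epi C q \<longleftrightarrow> (\<exists>f g. is_coequalizer C f g q)"

definition regular_category :: "('c, 'm, 'z) cat_scheme \<Rightarrow> bool" where
  "regular_category C \<longleftrightarrow> category C \<and> has_finite_limits C \<and>
     (\<forall>f p q. is_pullback C p q f f \<longrightarrow> (\<exists>k. is_coequalizer C p q k)) \<and>
     (\<forall>p q f g. is_pullback C p q f g \<and> is_regular_epi C f \<longrightarrow> is_regular_epi C q)"

text \<open>\<open>r\<^sub>1, r\<^sub>2\<close> is an internal equivalence relation on their common codomain.\<close>

definition is_equivalence_relation :: "('c, 'm, 'z) cat_scheme \<Rightarrow> 'm \<Rightarrow> 'm \<Rightarrow> bool" where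
  "is_equivalence_relation C r\<^sub>1 r\<^sub>2 \<longleftrightarrow>
     r\<^sub>1 \<in> Arr C \<and> r\<^sub>2 \<in> Hom C (Dom C r\<^sub>1) (Cod C r\<^sub>1) \<and>
     (\<forall>z. \<forall>a \<in> Hom C z (Dom C r\<^sub>1). \<forall>b \<in> Hom C z (Dom C r\<^sub>1).
        a \<Zsemi>\<^bsub>C\<^esub> r\<^sub>1 = b \<Zsemi>\<^bsub>C\<^esub> r\<^sub>1 \<and> a \<Zsemi>\<^bsub>C\<^esub> r\<^sub>2 = b \<Zsemi>\<^bsub>C\<^esub> r\<^sub>2 \<longrightarrow> a = b) \<and>
     (\<exists>d \<in> Hom C (Cod C r\<^sub>1) (Dom C r\<^sub>1).
        d \<Zsemi>\<^bsub>C\<^esub> r\<^sub>1 = Ident C (Cod C r\<^sub>1) \<and> d \<Zsemi>\<^bsub>C\<^esub> r\<^sub>2 = Ident C (Cod C r\<^sub>1)) \<and>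
     (\<exists>s \<in> Hom C (Dom C r\<^sub>1) (Dom C r\<^sub>1). s \<Zsemi>\<^bsub>C\<^esub> r\<^sub>1 = r\<^sub>2 \<and> s \<Zsemi>\<^bsub>C\<^esub> r\<^sub>2 = r\<^sub>1) \<and>
     (\<forall>p q. is_pullback C p q r\<^sub>2 r\<^sub>1 \<longrightarrow>
        (\<exists>m \<in> Hom C (Dom C p) (Dom C r\<^sub>1).
           m \<Zsemi>\<^bsub>C\<^esub> r\<^sub>1 = p \<Zsemi>\<^bsub>C\<^esub> r\<^sub>1 \<and> m \<Zsemi>\<^bsub>C\<^esub> r\<^sub>2 = q \<Zsemi>\<^bsub>C\<^esub> r\<^sub>2))"

definition barr_exact :: "('c, 'm, 'z) cat_scheme \<Rightarrow> bool" where
  "barr_exact C \<longleftrightarrow> regular_category C \<and>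
     (\<forall>r\<^sub>1 r\<^sub>2. is_equivalence_relation C r\<^sub>1 r\<^sub>2 \<longrightarrow> (\<exists>f. is_pullback C r\<^sub>1 r\<^sub>2 f f))"

text \<open>A point over \<open>b\<close> is a split epimorphism onto \<open>b\<close> with a chosen section.\<close>

definition is_point :: "('c, 'm, 'z) cat_scheme \<Rightarrow> 'c \<Rightarrow> 'm \<Rightarrow> 'm \<Rightarrow> bool" where
  "is_point C b p s \<longleftrightarrow> p \<in> Hom C (Dom C p) b \<and> s \<in> Hom C b (Dom C p) \<and>
     s \<Zsemi>\<^bsub>C\<^esub> p = Ident C b"

text \<open>Bourn's protomodularity: for every \<open>v : e \<rightarrow> b\<close>, pulling back along \<open>v\<close> is a
  conservative functor from points over \<open>b\<close> to points over \<open>e\<close>. Below, \<open>h\<close> is a morphism of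
  points from \<open>(p, s)\<close> to \<open>(p', s')\<close>, and \<open>k\<close> is its image under pullback along \<open>v\<close>.\<close>

definition protomodular :: "('c, 'm, 'z) cat_scheme \<Rightarrow> bool" where
  "protomodular C \<longleftrightarrow> has_pullbacks C \<and>
     (\<forall>v p s p' s' h u w u' w' k.
        v \<in> Arr C \<and> is_point C (Cod C v) p s \<and> is_point C (Cod C v) p' s' \<and>
        h \<in> Hom C (Dom C p) (Dom C p') \<and> h \<Zsemi>\<^bsub>C\<^esub> p' = p \<and> s \<Zsemi>\<^bsub>C\<^esub> h = s' \<and>
        is_pullback C u w v p \<and> is_pullback C u' w' v p' \<and>
        k \<in> Hom C (Dom C u) (Dom C u') \<and> k \<Zsemi>\<^bsub>C\<^esub> u' = u \<and> k \<Zsemi>\<^bsub>C\<^esub> w' = w \<Zsemi>\<^bsub>C\<^esub> h \<and>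
        is_iso C k
        \<longrightarrow> is_iso C h)"

definition semi_abelian_category :: "('c, 'm, 'z) cat_scheme \<Rightarrow> bool" where
  "semi_abelian_category C \<longleftrightarrow>
     barr_exact C \<and> protomodular C \<and> has_finite_coproducts C \<and> has_zero_object C"


section \<open>Algebraic theories and their algebras\<close>

text \<open>The object \<open>n\<close> stands for the power \<open>T\<^sup>n\<close>, and \<open>Proj T n i\<close> for the chosen \<open>i\<close>-th projection
  \<open>T\<^sup>n \<rightarrow> T\<close>, \<open>i < n\<close>.\<close>

record 'o lawvere = "(nat, 'o) cat" +
  Proj :: "nat \<Rightarrow> nat \<Rightarrow> 'o"

locale lawvere_theory = category T
  for T :: "'o lawvere" (structure) +
  assumes Obj_UNIV: "Obj T = UNIV"
    and Proj_in: "i < n \<Longrightarrow> Proj T n i \<in> Hom T n 1"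
    and Proj_1: "Proj T 1 0 = Ident T 1"
    and power: "(\<And>i. i < n \<Longrightarrow> f i \<in> Hom T m 1)
      \<Longrightarrow> \<exists>!h. h \<in> Hom T m n \<and> (\<forall>i<n. h \<Zsemi> Proj T n i = f i)"

text \<open>An \<open>n\<close>-tuple in \<open>A\<close> is an element of \<open>{..<n} \<rightarrow>\<^sub>E A\<close>. Only the values of \<open>Op A \<tau>\<close> on tuples of
  the right length, for \<open>\<tau>\<close> an operation, are relevant.\<close>

record ('o, 'a) alg =
  Carrier :: "'a set"
  Op :: "'o \<Rightarrow> (nat \<Rightarrow> 'a) \<Rightarrow> 'a"

text \<open>In \<open>Op_Comp\<close>, \<open>f : T\<^sup>m \<rightarrow> T\<^sup>n\<close> is the tuple of the \<open>m\<close>-ary operations \<open>f \<Zsemi> Proj T n i\<close>.\<close>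

locale theory_algebra = lawvere_theory T
  for T :: "'o lawvere" (structure) +
  fixes A :: "('o, 'a) alg"
  assumes Op_in: "\<lbrakk>\<tau> \<in> Hom T n 1; x \<in> {..<n} \<rightarrow>\<^sub>E Carrier A\<rbrakk> \<Longrightarrow> Op A \<tau> x \<in> Carrier A"
    and Op_Proj: "\<lbrakk>i < n; x \<in> {..<n} \<rightarrow>\<^sub>E Carrier A\<rbrakk> \<Longrightarrow> Op A (Proj T n i) x = x i"
    and Op_Comp: "\<lbrakk>f \<in> Hom T m n; \<tau> \<in> Hom T n 1; x \<in> {..<m} \<rightarrow>\<^sub>E Carrier A\<rbrakk>
      \<Longrightarrow> Op A (f \<Zsemi> \<tau>) x = Op A \<tau> (\<lambda>i\<in>{..<n}. Op A (f \<Zsemi> Proj T n i) x)"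

definition alg_hom :: "'o lawvere \<Rightarrow> ('o, 'a) alg \<Rightarrow> ('o, 'b) alg \<Rightarrow> ('a \<Rightarrow> 'b) \<Rightarrow> bool" where
  "alg_hom T A B f \<longleftrightarrow> f \<in> Carrier A \<rightarrow> Carrier B \<and>
     (\<forall>n. \<forall>\<tau> \<in> Hom T n 1. \<forall>x \<in> {..<n} \<rightarrow>\<^sub>E Carrier A.
        f (Op A \<tau> x) = Op B \<tau> (\<lambda>i\<in>{..<n}. f (x i)))"

text \<open>The category of \<open>T\<close>-algebras with carrier in the type \<open>'u\<close>; an arrow is a homomorphism
  together with its domain and codomain.\<close>

definition alg_category ::
    "'o lawvere \<Rightarrow> (('o, 'u) alg, ('o, 'u) alg \<times> ('u \<Rightarrow> 'u) \<times> ('o, 'u) alg) cat" where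
  "alg_category T =
    \<lparr>Obj = {A. theory_algebra T A},
     Arr = {(A, f, B). theory_algebra T A \<and> theory_algebra T B \<and> f \<in> extensional (Carrier A) \<and> alg_hom T A B f},
     Dom = (\<lambda>(A, f, B). A),
     Cod = (\<lambda>(A, f, B). B),
     Ident = (\<lambda>A. (A, \<lambda>x\<in>Carrier A. x, A)),
     Comp = (\<lambda>(A, f, B) (B', g, C). (A, compose (Carrier A) g f, C))\<rparr>"

text \<open>HOL has no type of all sets, so the category of algebras is taken over the universe
  \<open>'o + nat\<close>. This type is infinite and at least as large as the set of operations of \<open>T\<close>, so up to
  isomorphism the algebras living in it are all those of cardinality at most that of \<open>'o + nat\<close>:
  they include the finitely generated free algebras and are closed under subalgebras, quotients,
  finite products and finite coproducts. Hence the condition below holds for this universe if and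
  only if it holds for any larger one.\<close>

definition semi_abelian_theory :: "'o lawvere \<Rightarrow> bool" where
  "semi_abelian_theory T \<longleftrightarrow> lawvere_theory T \<and>
     semi_abelian_category
       (alg_category T :: (('o, 'o + nat) alg,
          ('o, 'o + nat) alg \<times> ('o + nat \<Rightarrow> 'o + nat) \<times> ('o, 'o + nat) alg) cat)"

definition topological_algebra :: "'o lawvere \<Rightarrow> ('o, 'a) alg \<Rightarrow> 'a topology \<Rightarrow> bool" where
  "topological_algebra T A X \<longleftrightarrow> theory_algebra T A \<and> topspace X = Carrier A \<and>
     (\<forall>n. \<forall>\<tau> \<in> Hom T n 1. continuous_map (product_topology (\<lambda>_. X) {..<n}) X (Op A \<tau>))"


section \<open>Internal groupoids in the category of algebras\<close>

record ('c, 'm) grpd = "('c, 'm) cat" +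
  Inv :: "'m \<Rightarrow> 'm"

locale groupoid = category G
  for G :: "('c, 'm) grpd" (structure) +
  assumes Inv_in: "g \<in> Hom G a b \<Longrightarrow> Inv G g \<in> Hom G b a"
    and Inv_right: "g \<in> Hom G a b \<Longrightarrow> g \<Zsemi> Inv G g = Ident G a"
    and Inv_left: "g \<in> Hom G a b \<Longrightarrow> Inv G g \<Zsemi> g = Ident G b"

text \<open>The algebra of composable pairs, with componentwise operations.\<close>

definition composable_alg ::
    "'o lawvere \<Rightarrow> ('c, 'm) grpd \<Rightarrow> ('o, 'm) alg \<Rightarrow> ('o, 'm \<times> 'm) alg" where
  "composable_alg T G M =
    \<lparr>Carrier = {(g, h). g \<in> Arr G \<and> h \<in> Arr G \<and> Cod G g = Dom G h},
     Op = (\<lambda>\<tau> x. (Op M \<tau> (\<lambda>i\<in>{..<Dom T \<tau>}. fst (x i)), Op M \<tau> (\<lambda>i\<in>{..<Dom T \<tau>}. snd (x i))))\<rparr>"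

text \<open>\<open>A\<close> and \<open>M\<close> are the algebra structures on the objects and on the arrows of \<open>G\<close>.\<close>

definition internal_groupoid ::
    "'o lawvere \<Rightarrow> ('o, 'c) alg \<Rightarrow> ('o, 'm) alg \<Rightarrow> ('c, 'm) grpd \<Rightarrow> bool" where
  "internal_groupoid T A M G \<longleftrightarrow>
     groupoid G \<and>
     theory_algebra T A \<and> Carrier A = Obj G \<and>
     theory_algebra T M \<and> Carrier M = Arr G \<and>
     alg_hom T M A (Dom G) \<and> alg_hom T M A (Cod G) \<and> alg_hom T A M (Ident G) \<and>
     theory_algebra T (composable_alg T G M) \<and>
     alg_hom T (composable_alg T G M) M (\<lambda>(g, h). g \<Zsemi>\<^bsub>G\<^esub> h) \<and>
     alg_hom T M M (Inv G)"


section \<open>The fundamental groupoid\<close>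

text \<open>The library's \<open>joinpaths\<close> and \<open>homotopic_paths\<close> are tied to the type class of topological
  spaces; these are their counterparts for an abstract topology.\<close>

definition path_concat :: "(real \<Rightarrow> 'a) \<Rightarrow> (real \<Rightarrow> 'a) \<Rightarrow> real \<Rightarrow> 'a" where
  "path_concat p q = (\<lambda>t. if t \<le> 1/2 then p (2 * t) else q (2 * t - 1))"

definition path_homotopic :: "'a topology \<Rightarrow> (real \<Rightarrow> 'a) \<Rightarrow> (real \<Rightarrow> 'a) \<Rightarrow> bool" where
  "path_homotopic X p q \<longleftrightarrow>
     homotopic_with (\<lambda>r. r 0 = p 0 \<and> r 1 = p 1) (top_of_set {0..1}) X p q"

definition path_class :: "'a topology \<Rightarrow> (real \<Rightarrow> 'a) \<Rightarrow> (real \<Rightarrow> 'a) set" where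
  "path_class X p = {q. path_homotopic X p q}"

text \<open>Operations on classes are defined as the set of all paths homotopic to the result of the
  operation on some choice of representatives.\<close>

definition fundamental_groupoid :: "'a topology \<Rightarrow> ('a, (real \<Rightarrow> 'a) set) grpd" where
  "fundamental_groupoid X =
    \<lparr>Obj = topspace X,
     Arr = {path_class X p | p. pathin X p},
     Dom = (\<lambda>c. THE x. \<forall>p\<in>c. p 0 = x),
     Cod = (\<lambda>c. THE x. \<forall>p\<in>c. p 1 = x),
     Ident = (\<lambda>x. path_class X (\<lambda>_. x)),
     Comp = (\<lambda>c d. {r. \<exists>p\<in>c. \<exists>q\<in>d. path_homotopic X (path_concat p q) r}),
     Inv = (\<lambda>c. {r. \<exists>p\<in>c. path_homotopic X (\<lambda>t. p (1 - t)) r})\<rparr>"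

text \<open>The path \<open>\<tau>(\<beta>\<^sub>0, \<dots>, \<beta>\<^sub>n\<^sub>-\<^sub>1)\<close>.\<close>

definition path_op :: "'o lawvere \<Rightarrow> ('o, 'a) alg \<Rightarrow> 'o \<Rightarrow> (nat \<Rightarrow> real \<Rightarrow> 'a) \<Rightarrow> real \<Rightarrow> 'a" where
  "path_op T A \<tau> \<beta> = (\<lambda>t. Op A \<tau> (\<lambda>i\<in>{..<Dom T \<tau>}. \<beta> i t))"

definition path_class_alg ::
    "'o lawvere \<Rightarrow> ('o, 'a) alg \<Rightarrow> 'a topology \<Rightarrow> ('o, (real \<Rightarrow> 'a) set) alg" where
  "path_class_alg T A X =
    \<lparr>Carrier = Arr (fundamental_groupoid X),
     Op = (\<lambda>\<tau> c. {r. \<exists>\<beta>. (\<forall>i<Dom T \<tau>. \<beta> i \<in> c i) \<and> path_homotopic X (path_op T A \<tau> \<beta>) r})\<rparr>"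

end

theory Submission
  imports Defs
begin

text \<open>
  Write \<open>I\<close> for the unit interval.  Two observations carry the proof.

  First, every operation that the statement puts on homotopy classes is computed on
  representatives: a continuous construction on paths can be applied to each stage of a homotopy
  relative to end points, so concatenation, reversal and the pointwise application of an operation
  \<open>\<tau>\<close> all respect homotopy (\<open>path_homotopic_concat\<close>, \<open>path_homotopic_reverse\<close>,
  \<open>path_homotopic_path_op\<close>).  For \<open>\<tau>\<close> this uses the continuity of \<open>\<tau>\<close> on the product
  \<open>A\<^sup>n\<close>, together with the fact that finitely many homotopies form one homotopy into \<open>A\<^sup>n\<close>.

  Second, once classes are replaced by paths, each required identity between paths either holds
  exactly on \<open>I\<close>, or holds up to a change of parameter.  The groupoid laws are of the latter kind:
  both sides are the same path precomposed with two self-maps of \<open>I\<close> agreeing at \<open>0\<close> and \<open>1\<close>,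
  and such self-maps are joined by a straight-line homotopy (\<open>path_homotopic_reparametrization\<close>).
  The compatibility of \<open>\<tau>\<close> with source, target, identities, composition and inversion, and the
  equations of the theory for arrows, are of the former kind: \<open>\<tau>\<close> acts pointwise in the
  parameter, whereas concatenation and reversal only move the parameter.  Thus the arrows inherit
  every equation that holds in \<open>A\<close>.
\<close>

section \<open>Homotopy of paths in an abstract topology\<close>

abbreviation unit_interval :: "real topology" where
  "unit_interval \<equiv> top_of_set {0..1}"

text \<open>The library notion of homotopy prescribes the two end stages on the whole type; paths only
  matter on \<open>{0..1}\<close>, and this form of the introduction rule only asks for values there.\<close>

lemma path_homotopicI:
  assumes "continuous_map (prod_topology unit_interval unit_interval) X h"
    and "\<And>s. s \<in> {0..1} \<Longrightarrow> h (0, s) = p s"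
    and "\<And>s. s \<in> {0..1} \<Longrightarrow> h (1, s) = q s"
    and "\<And>t. t \<in> {0..1} \<Longrightarrow> h (t, 0) = p 0"
    and "\<And>t. t \<in> {0..1} \<Longrightarrow> h (t, 1) = p 1"
  shows "path_homotopic X p q"
  unfolding path_homotopic_def
proof (subst homotopic_with)
  show "(k 0 = p 0 \<and> k 1 = p 1) = (k' 0 = p 0 \<and> k' 1 = p 1)"
    if "\<And>x. x \<in> topspace unit_interval \<Longrightarrow> k x = k' x" for k k' :: "real \<Rightarrow> 'a"
    using that[of 0] that[of 1] by simp
qed (use assms in \<open>auto intro!: exI[of _ h]\<close>)

lemma path_homotopicE:
  assumes "path_homotopic X p q"
  obtains h where "continuous_map (prod_topology unit_interval unit_interval) X h"
    and "\<And>s. h (0, s) = p s" and "\<And>s. h (1, s) = q s"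
    and "\<And>t. t \<in> {0..1} \<Longrightarrow> h (t, 0) = p 0"
    and "\<And>t. t \<in> {0..1} \<Longrightarrow> h (t, 1) = p 1"
  using assms unfolding path_homotopic_def homotopic_with_def by auto

lemma path_homotopic_endpoints:
  assumes "path_homotopic X p q"
  shows "q 0 = p 0" "q 1 = p 1"
  using assms homotopic_with_imp_property unfolding path_homotopic_def by blast+

lemma path_homotopic_sym:
  assumes "path_homotopic X p q"
  shows "path_homotopic X q p"
  using assms path_homotopic_endpoints[OF assms] unfolding path_homotopic_def
  by (simp add: homotopic_with_sym)

lemma path_homotopic_trans:
  assumes "path_homotopic X p q" "path_homotopic X q r"
  shows "path_homotopic X p r"
  using assms path_homotopic_endpoints[OF assms(1)] unfolding path_homotopic_def
  by (auto intro: homotopic_with_trans)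

text \<open>Paths with the same values on \<open>{0..1}\<close> are homotopic, although they may differ as
  functions on the reals.\<close>

lemma path_homotopic_eq:
  assumes "pathin X p" "\<And>s. s \<in> {0..1} \<Longrightarrow> p s = q s"
  shows "path_homotopic X p q"
proof (rule path_homotopicI)
  have "continuous_map (prod_topology unit_interval unit_interval) X (p \<circ> snd)"
    using assms(1) unfolding pathin_def by (rule continuous_map_compose[OF continuous_map_snd])
  then show "continuous_map (prod_topology unit_interval unit_interval) X (\<lambda>z. p (snd z))"
    by (simp add: o_def)
qed (use assms in auto)

lemma path_homotopic_refl: "pathin X p \<Longrightarrow> path_homotopic X p p"
  by (rule path_homotopic_eq) auto

lemma prod_unit_interval:
  "prod_topology unit_interval unit_interval = top_of_set ({0..1} \<times> {0..1})"
  by (simp add: subtopology_Times)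

text \<open>The source of the groupoid laws: \<open>I\<close> is convex, so two self-maps of \<open>I\<close> with the same
  end points are joined by a straight-line homotopy, to which the path can be applied.\<close>

lemma path_homotopic_reparametrization:
  assumes p: "pathin X p"
    and f: "continuous_on {0..1} f" "f \<in> {0..1} \<rightarrow> {0..1}"
    and g: "continuous_on {0..1} g" "g \<in> {0..1} \<rightarrow> {0..1}"
    and ends: "f 0 = g 0" "f 1 = g 1"
  shows "path_homotopic X (\<lambda>s. p (f s)) (\<lambda>s. p (g s))"
proof -
  define k where "k = (\<lambda>z. (1 - fst z) * f (snd z) + fst z * g (snd z))"
  have fs: "continuous_on ({0..1::real} \<times> {0..1}) (\<lambda>z. f (snd z))"
    by (rule continuous_on_compose2[OF f(1)]) (auto intro: continuous_intros)
  have gs: "continuous_on ({0..1::real} \<times> {0..1}) (\<lambda>z. g (snd z))"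
    by (rule continuous_on_compose2[OF g(1)]) (auto intro: continuous_intros)
  have "continuous_on ({0..1} \<times> {0..1}) k"
    unfolding k_def by (intro continuous_intros fs gs)
  moreover have "k \<in> {0..1} \<times> {0..1} \<rightarrow> {0..1}"
  proof
    fix z :: "real \<times> real"
    assume "z \<in> {0..1} \<times> {0..1}"
    then have fst_z: "0 \<le> fst z" "0 \<le> 1 - fst z" and snd_z: "snd z \<in> {0..1}"
      by auto
    have "f (snd z) \<in> {0..1}" "g (snd z) \<in> {0..1}"
      using f(2) g(2) snd_z by (blast intro: funcset_mem)+
    then have "0 \<le> k z" "k z \<le> 1"
      unfolding k_def using fst_z by (simp_all add: convex_bound_le)
    then show "k z \<in> {0..1}" by simp
  qed
  ultimately have "continuous_map (prod_topology unit_interval unit_interval) unit_interval k"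
    unfolding prod_unit_interval by (auto simp: Pi_def image_subset_iff)
  then have "continuous_map (prod_topology unit_interval unit_interval) X (p \<circ> k)"
    using p unfolding pathin_def by (rule continuous_map_compose)
  then show ?thesis
    by (rule path_homotopicI) (auto simp: k_def ends algebra_simps)
qed

text \<open>The truncations \<open>min 1 (2 * s)\<close> and \<open>max 0 (2 * s - 1)\<close> change nothing on the halves
  where the two pieces are used, but make both pieces continuous on all of \<open>Z\<close>, so that the two
  pieces can be glued along \<open>s = 1/2\<close>.\<close>

lemma continuous_map_concat:
  assumes s: "continuous_map Z unit_interval s"
    and h: "continuous_map (prod_topology Z unit_interval) X h"
    and k: "continuous_map (prod_topology Z unit_interval) X k"
    and eq: "\<And>z. z \<in> topspace Z \<Longrightarrow> h (z, 1) = k (z, 0)"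
  shows "continuous_map Z X
           (\<lambda>z. if s z \<le> 1/2 then h (z, 2 * s z) else k (z, 2 * s z - 1))"
proof -
  have real_s: "continuous_map Z euclideanreal s"
    using s continuous_map_into_fulltopology by blast
  have range_s: "s z \<in> {0..1}" if "z \<in> topspace Z" for z
    using s that by (auto simp: continuous_map_def Pi_def)
  have "continuous_map Z unit_interval (\<lambda>z. min 1 (2 * s z))"
    unfolding continuous_map_in_subtopology
    by (intro conjI continuous_intros real_s) (use range_s in fastforce)
  then have "continuous_map Z X (h \<circ> (\<lambda>z. (z, min 1 (2 * s z))))"
    by (intro continuous_map_compose[OF _ h] continuous_map_pairedI) auto
  then have h': "continuous_map Z X (\<lambda>z. h (z, min 1 (2 * s z)))"
    by (simp add: o_def)
  have "continuous_map Z unit_interval (\<lambda>z. max 0 (2 * s z - 1))"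
    unfolding continuous_map_in_subtopology
    by (intro conjI continuous_intros real_s) (use range_s in fastforce)
  then have "continuous_map Z X (k \<circ> (\<lambda>z. (z, max 0 (2 * s z - 1))))"
    by (intro continuous_map_compose[OF _ k] continuous_map_pairedI) auto
  then have k': "continuous_map Z X (\<lambda>z. k (z, max 0 (2 * s z - 1)))"
    by (simp add: o_def)
  have "continuous_map Z X (\<lambda>z. if s z \<le> 1/2 then h (z, min 1 (2 * s z))
                                   else k (z, max 0 (2 * s z - 1)))"
    by (rule continuous_map_cases_le)
       (use real_s h' k' eq in \<open>auto intro: continuous_map_from_subtopology\<close>)
  moreover have "(if s z \<le> 1/2 then h (z, min 1 (2 * s z)) else k (z, max 0 (2 * s z - 1)))
      = (if s z \<le> 1/2 then h (z, 2 * s z) else k (z, 2 * s z - 1))" for z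
    by (cases "s z \<le> 1/2") (simp_all add: min_absorb2 max_absorb2)
  ultimately show ?thesis by simp
qed

lemma pathin_concat:
  assumes "pathin X p" "pathin X q" "p 1 = q 0"
  shows "pathin X (path_concat p q)"
proof -
  have "continuous_map unit_interval X
          (\<lambda>z. if z \<le> 1/2 then (p \<circ> snd) (z, 2 * z) else (q \<circ> snd) (z, 2 * z - 1))"
    using assms unfolding pathin_def
    by (intro continuous_map_concat continuous_map_compose[OF continuous_map_snd]) auto
  then show ?thesis
    by (simp add: pathin_def path_concat_def cong: if_cong)
qed

lemma pathin_reverse:
  assumes "pathin X p"
  shows "pathin X (\<lambda>t. p (1 - t))"
proof -
  have "continuous_map unit_interval unit_interval (\<lambda>t. 1 - t)"
    by (auto intro!: continuous_intros)
  from continuous_map_compose[OF this, of X p] assms show ?thesis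
    by (simp add: pathin_def o_def)
qed

text \<open>Each stage of the homotopy is the concatenation of the two given stages; they match at
  the junction because both homotopies fix end points.\<close>

lemma path_homotopic_concat:
  assumes p: "path_homotopic X p p'" and q: "path_homotopic X q q'" and pq: "p 1 = q 0"
  shows "path_homotopic X (path_concat p q) (path_concat p' q')"
proof -
  let ?Z = "prod_topology unit_interval unit_interval"
  obtain h where h: "continuous_map ?Z X h" "\<And>s. h (0, s) = p s" "\<And>s. h (1, s) = p' s"
    "\<And>t. t \<in> {0..1} \<Longrightarrow> h (t, 0) = p 0" "\<And>t. t \<in> {0..1} \<Longrightarrow> h (t, 1) = p 1"
    using p by (rule path_homotopicE) blast
  obtain k where k: "continuous_map ?Z X k" "\<And>s. k (0, s) = q s" "\<And>s. k (1, s) = q' s"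
    "\<And>t. t \<in> {0..1} \<Longrightarrow> k (t, 0) = q 0" "\<And>t. t \<in> {0..1} \<Longrightarrow> k (t, 1) = q 1"
    using q by (rule path_homotopicE) blast
  \<comment> \<open>Replacing the second coordinate of a point of the square turns maps on the square into
    the three-variable maps that the gluing lemma expects.\<close>
  define c where "c = (\<lambda>w :: (real \<times> real) \<times> real. (fst (fst w), snd w))"
  have "continuous_map (prod_topology ?Z unit_interval) unit_interval (fst \<circ> fst)"
    by (intro continuous_map_compose[OF continuous_map_fst continuous_map_fst])
  then have c: "continuous_map (prod_topology ?Z unit_interval) ?Z c"
    unfolding c_def by (intro continuous_map_pairedI continuous_map_snd) (simp add: o_def)
  have "continuous_map ?Z X
      (\<lambda>z. if snd z \<le> 1/2 then (h \<circ> c) (z, 2 * snd z) else (k \<circ> c) (z, 2 * snd z - 1))"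
    by (intro continuous_map_concat continuous_map_snd continuous_map_compose[OF c] h(1) k(1))
       (auto simp: c_def h k pq)
  then show ?thesis
    by (rule path_homotopicI) (auto simp: c_def h k path_concat_def)
qed

lemma path_homotopic_reverse:
  assumes "path_homotopic X p q"
  shows "path_homotopic X (\<lambda>t. p (1 - t)) (\<lambda>t. q (1 - t))"
proof -
  let ?Z = "prod_topology unit_interval unit_interval"
  obtain h where h: "continuous_map ?Z X h" "\<And>s. h (0, s) = p s" "\<And>s. h (1, s) = q s"
    "\<And>t. t \<in> {0..1} \<Longrightarrow> h (t, 0) = p 0" "\<And>t. t \<in> {0..1} \<Longrightarrow> h (t, 1) = p 1"
    using assms by (rule path_homotopicE) blast
  have "continuous_map ?Z ?Z (\<lambda>z. (fst z, 1 - snd z))"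
    unfolding prod_unit_interval by (auto intro!: continuous_intros)
  then have "continuous_map ?Z X (h \<circ> (\<lambda>z. (fst z, 1 - snd z)))"
    using h(1) by (rule continuous_map_compose)
  then show ?thesis
    by (rule path_homotopicI) (auto simp: h)
qed


section \<open>The fundamental groupoid is a groupoid\<close>

lemma mem_path_class_self: "pathin X p \<Longrightarrow> p \<in> path_class X p"
  by (simp add: path_class_def path_homotopic_refl)

lemma path_class_endpoints:
  assumes "q \<in> path_class X p"
  shows "q 0 = p 0" "q 1 = p 1"
  using assms path_homotopic_endpoints unfolding path_class_def by blast+

lemma path_class_eqI: "path_homotopic X p q \<Longrightarrow> path_class X p = path_class X q"
  unfolding path_class_def using path_homotopic_sym path_homotopic_trans by blast

lemma path_class_eq_on:
  assumes "pathin X p" "\<And>s. s \<in> {0..1} \<Longrightarrow> p s = q s"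
  shows "path_class X p = path_class X q"
  using assms by (intro path_class_eqI path_homotopic_eq)

lemma Obj_fundamental_groupoid: "Obj (fundamental_groupoid X) = topspace X"
  by (simp add: fundamental_groupoid_def)

lemma Arr_fundamental_groupoid: "Arr (fundamental_groupoid X) = {path_class X p | p. pathin X p}"
  by (simp add: fundamental_groupoid_def)

lemma Ident_fundamental_groupoid: "Ident (fundamental_groupoid X) x = path_class X (\<lambda>_. x)"
  by (simp add: fundamental_groupoid_def)

lemma Dom_path_class:
  assumes "pathin X p"
  shows "Dom (fundamental_groupoid X) (path_class X p) = p 0"
proof -
  have "(THE x. \<forall>q \<in> path_class X p. q 0 = x) = p 0"
  proof (rule the_equality)
    show "\<forall>q \<in> path_class X p. q 0 = p 0"
      using path_class_endpoints by blast
  qed (use mem_path_class_self[OF assms] in auto)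
  then show ?thesis by (simp add: fundamental_groupoid_def)
qed

lemma Cod_path_class:
  assumes "pathin X p"
  shows "Cod (fundamental_groupoid X) (path_class X p) = p 1"
proof -
  have "(THE x. \<forall>q \<in> path_class X p. q 1 = x) = p 1"
  proof (rule the_equality)
    show "\<forall>q \<in> path_class X p. q 1 = p 1"
      using path_class_endpoints by blast
  qed (use mem_path_class_self[OF assms] in auto)
  then show ?thesis by (simp add: fundamental_groupoid_def)
qed

lemma Comp_path_class:
  assumes "pathin X p" "pathin X q" "p 1 = q 0"
  shows "path_class X p \<Zsemi>\<^bsub>fundamental_groupoid X\<^esub> path_class X q = path_class X (path_concat p q)"
proof -
  have "(\<exists>p' \<in> path_class X p. \<exists>q' \<in> path_class X q. path_homotopic X (path_concat p' q') r)
      \<longleftrightarrow> path_homotopic X (path_concat p q) r" for r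
    using assms mem_path_class_self path_homotopic_concat path_homotopic_trans
    unfolding path_class_def by (metis mem_Collect_eq)
  then show ?thesis
    by (simp add: fundamental_groupoid_def path_class_def[of X "path_concat p q"])
qed

lemma Inv_path_class:
  assumes "pathin X p"
  shows "Inv (fundamental_groupoid X) (path_class X p) = path_class X (\<lambda>t. p (1 - t))"
proof -
  have "(\<exists>p' \<in> path_class X p. path_homotopic X (\<lambda>t. p' (1 - t)) r)
      \<longleftrightarrow> path_homotopic X (\<lambda>t. p (1 - t)) r" for r
    using mem_path_class_self[OF assms] path_homotopic_trans
      path_homotopic_reverse[of X p]
    unfolding path_class_def by blast
  then show ?thesis
    by (simp add: fundamental_groupoid_def path_class_def[of X "\<lambda>t. p (1 - t)"])
qed

lemma Hom_fundamental_groupoid_iff: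
  "c \<in> Hom (fundamental_groupoid X) a b \<longleftrightarrow>
     (\<exists>p. pathin X p \<and> p 0 = a \<and> p 1 = b \<and> c = path_class X p)"
  unfolding Hom_def Arr_fundamental_groupoid
  by (auto simp: Dom_path_class Cod_path_class)

lemma path_concat_ends: "path_concat p q 0 = p 0" "path_concat p q 1 = q 1"
  by (simp_all add: path_concat_def)

lemma pathin_in_topspace:
  assumes "pathin X p" "s \<in> {0..1}"
  shows "p s \<in> topspace X"
  using assms by (auto simp: pathin_def continuous_map_def Pi_def)

lemma pathin_ends:
  assumes "pathin X p"
  shows "p 0 \<in> topspace X" "p 1 \<in> topspace X"
  using pathin_in_topspace[OF assms] by simp_all

text \<open>The unit, associativity and inverse laws.  In the first two, one side is a
  reparametrization of the other; in the last, the path that runs along \<open>p\<close> and back and the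
  constant path are both reparametrizations of \<open>p\<close>.\<close>

lemma path_class_concat_const_left:
  assumes "pathin X p"
  shows "path_class X (path_concat (\<lambda>_. p 0) p) = path_class X p"
proof -
  have eq: "path_concat (\<lambda>_. p 0) p = (\<lambda>s. p (max 0 (2 * s - 1)))"
  proof
    show "path_concat (\<lambda>_. p 0) p s = p (max 0 (2 * s - 1))" for s
      by (cases "s \<le> 1/2") (simp_all add: path_concat_def max_absorb1 max_absorb2)
  qed
  have "path_homotopic X (\<lambda>s. p (max 0 (2 * s - 1))) (\<lambda>s. p s)"
    using assms by (rule path_homotopic_reparametrization) (auto intro!: continuous_intros)
  then show ?thesis unfolding eq by (rule path_class_eqI)
qed

lemma path_class_concat_const_right:
  assumes "pathin X p"
  shows "path_class X (path_concat p (\<lambda>_. p 1)) = path_class X p"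
proof -
  have eq: "path_concat p (\<lambda>_. p 1) = (\<lambda>s. p (min 1 (2 * s)))"
  proof
    show "path_concat p (\<lambda>_. p 1) s = p (min 1 (2 * s))" for s
      by (cases "s \<le> 1/2") (simp_all add: path_concat_def min_absorb1 min_absorb2)
  qed
  have "path_homotopic X (\<lambda>s. p (min 1 (2 * s))) (\<lambda>s. p s)"
    using assms by (rule path_homotopic_reparametrization) (auto intro!: continuous_intros)
  then show ?thesis unfolding eq by (rule path_class_eqI)
qed

lemma path_class_concat_assoc:
  assumes "pathin X p" "pathin X q" "pathin X r" "p 1 = q 0" "q 1 = r 0"
  shows "path_class X (path_concat (path_concat p q) r)
       = path_class X (path_concat p (path_concat q r))"
proof -
  let ?c = "path_concat p (path_concat q r)"
  \<comment> \<open>The piecewise linear map taking the breakpoints \<open>1/4\<close> and \<open>1/2\<close> of the left-hand side to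
    the breakpoints \<open>1/2\<close> and \<open>3/4\<close> of the right-hand side; it is concave, hence a minimum of
    its three linear pieces.\<close>
  define \<phi> :: "real \<Rightarrow> real" where "\<phi> = (\<lambda>s. min (2 * s) (min (s + 1/4) ((s + 1) / 2)))"
  have eq: "path_concat (path_concat p q) r = (\<lambda>s. ?c (\<phi> s))"
  proof
    fix s :: real
    consider "s \<le> 1/4" | "1/4 < s" "s \<le> 1/2" | "1/2 < s" by linarith
    then show "path_concat (path_concat p q) r s = ?c (\<phi> s)"
    proof cases
      case 1
      then have "\<phi> s = 2 * s" by (auto simp: \<phi>_def min_def)
      then show ?thesis using 1 by (simp add: path_concat_def)
    next
      case 2
      then have "\<phi> s = s + 1/4" by (auto simp: \<phi>_def min_def)
      then show ?thesis using 2 by (simp add: path_concat_def algebra_simps)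
    next
      case 3
      then have "\<phi> s = (s + 1) / 2" by (auto simp: \<phi>_def min_def field_simps)
      then show ?thesis using 3 by (simp add: path_concat_def algebra_simps)
    qed
  qed
  have "pathin X ?c"
    using assms by (intro pathin_concat) (auto simp: path_concat_ends)
  then have "path_homotopic X (\<lambda>s. ?c (\<phi> s)) (\<lambda>s. ?c s)"
    by (rule path_homotopic_reparametrization)
       (auto simp: \<phi>_def min_le_iff_disj intro!: continuous_intros)
  then show ?thesis unfolding eq by (rule path_class_eqI)
qed

lemma path_class_concat_reverse_right:
  assumes "pathin X p"
  shows "path_class X (path_concat p (\<lambda>t. p (1 - t))) = path_class X (\<lambda>_. p 0)"
proof -
  have eq: "path_concat p (\<lambda>t. p (1 - t)) = (\<lambda>s. p (min (2 * s) (2 - 2 * s)))"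
    by (auto simp: path_concat_def min_def fun_eq_iff)
  have "path_homotopic X (\<lambda>s. p (min (2 * s) (2 - 2 * s))) (\<lambda>s. p 0)"
    using assms by (rule path_homotopic_reparametrization) (auto intro!: continuous_intros)
  then show ?thesis unfolding eq by (rule path_class_eqI)
qed

lemma path_class_concat_reverse_left:
  assumes "pathin X p"
  shows "path_class X (path_concat (\<lambda>t. p (1 - t)) p) = path_class X (\<lambda>_. p 1)"
  using path_class_concat_reverse_right[OF pathin_reverse[OF assms]] by simp

lemma category_fundamental_groupoid: "category (fundamental_groupoid X)"
proof
  fix c assume "c \<in> Arr (fundamental_groupoid X)"
  then obtain p where p: "pathin X p" "c = path_class X p"
    by (auto simp: Arr_fundamental_groupoid)
  then show "Dom (fundamental_groupoid X) c \<in> Obj (fundamental_groupoid X)"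
    and "Cod (fundamental_groupoid X) c \<in> Obj (fundamental_groupoid X)"
    by (simp_all add: Obj_fundamental_groupoid Dom_path_class Cod_path_class pathin_ends)
next
  fix a assume "a \<in> Obj (fundamental_groupoid X)"
  then have "pathin X (\<lambda>_. a)"
    by (simp add: Obj_fundamental_groupoid)
  then show "Ident (fundamental_groupoid X) a \<in> Hom (fundamental_groupoid X) a a"
    unfolding Hom_fundamental_groupoid_iff Ident_fundamental_groupoid by blast
next
  fix a b c f g
  assume "f \<in> Hom (fundamental_groupoid X) a b" "g \<in> Hom (fundamental_groupoid X) b c"
  then obtain p q where pq: "pathin X p" "p 0 = a" "p 1 = b" "f = path_class X p"
    "pathin X q" "q 0 = b" "q 1 = c" "g = path_class X q"
    unfolding Hom_fundamental_groupoid_iff by blast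
  then have "f \<Zsemi>\<^bsub>fundamental_groupoid X\<^esub> g = path_class X (path_concat p q)"
    by (simp add: Comp_path_class)
  moreover have "pathin X (path_concat p q)" "path_concat p q 0 = a" "path_concat p q 1 = c"
    using pq by (simp_all add: pathin_concat path_concat_ends)
  ultimately show "f \<Zsemi>\<^bsub>fundamental_groupoid X\<^esub> g \<in> Hom (fundamental_groupoid X) a c"
    unfolding Hom_fundamental_groupoid_iff by blast
next
  fix a b f
  assume "f \<in> Hom (fundamental_groupoid X) a b"
  then obtain p where p: "pathin X p" "p 0 = a" "p 1 = b" "f = path_class X p"
    unfolding Hom_fundamental_groupoid_iff by blast
  then have const: "pathin X (\<lambda>_. p 0)" "pathin X (\<lambda>_. p 1)"
    using pathin_ends[OF p(1)] by simp_all
  show "Ident (fundamental_groupoid X) a \<Zsemi>\<^bsub>fundamental_groupoid X\<^esub> f = f"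
    using Comp_path_class[OF const(1) p(1)] path_class_concat_const_left[OF p(1)] p
    by (simp add: Ident_fundamental_groupoid)
  show "f \<Zsemi>\<^bsub>fundamental_groupoid X\<^esub> Ident (fundamental_groupoid X) b = f"
    using Comp_path_class[OF p(1) const(2)] path_class_concat_const_right[OF p(1)] p
    by (simp add: Ident_fundamental_groupoid)
next
  fix a b c d f g h
  assume "f \<in> Hom (fundamental_groupoid X) a b" "g \<in> Hom (fundamental_groupoid X) b c"
    "h \<in> Hom (fundamental_groupoid X) c d"
  then obtain p q r where "pathin X p" "p 1 = b" "f = path_class X p"
    "pathin X q" "q 0 = b" "q 1 = c" "g = path_class X q"
    "pathin X r" "r 0 = c" "h = path_class X r"
    unfolding Hom_fundamental_groupoid_iff by blast
  then show "f \<Zsemi>\<^bsub>fundamental_groupoid X\<^esub> g \<Zsemi>\<^bsub>fundamental_groupoid X\<^esub> h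
      = f \<Zsemi>\<^bsub>fundamental_groupoid X\<^esub> (g \<Zsemi>\<^bsub>fundamental_groupoid X\<^esub> h)"
    by (simp add: Comp_path_class pathin_concat path_concat_ends path_class_concat_assoc)
qed

lemma groupoid_fundamental_groupoid: "groupoid (fundamental_groupoid X)"
proof (intro groupoid.intro category_fundamental_groupoid groupoid_axioms.intro)
  fix a b f
  assume "f \<in> Hom (fundamental_groupoid X) a b"
  then obtain p where p: "pathin X p" "p 0 = a" "p 1 = b" "f = path_class X p"
    unfolding Hom_fundamental_groupoid_iff by blast
  note rev = pathin_reverse[OF p(1)]
  show "Inv (fundamental_groupoid X) f \<in> Hom (fundamental_groupoid X) b a"
    unfolding Hom_fundamental_groupoid_iff p(4) Inv_path_class[OF p(1)]
    using rev p by (intro exI[of _ "\<lambda>t. p (1 - t)"]) auto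
  show "f \<Zsemi>\<^bsub>fundamental_groupoid X\<^esub> Inv (fundamental_groupoid X) f
      = Ident (fundamental_groupoid X) a"
    using p rev path_class_concat_reverse_right[OF p(1)]
    by (simp add: Inv_path_class Comp_path_class Ident_fundamental_groupoid)
  show "Inv (fundamental_groupoid X) f \<Zsemi>\<^bsub>fundamental_groupoid X\<^esub> f
      = Ident (fundamental_groupoid X) b"
    using p rev path_class_concat_reverse_left[OF p(1)]
    by (simp add: Inv_path_class Comp_path_class Ident_fundamental_groupoid)
qed


section \<open>Operations on paths and on their classes\<close>

lemma HomD:
  assumes "f \<in> Hom C a b"
  shows "f \<in> Arr C" "Dom C f = a" "Cod C f = b"
  using assms by (auto simp: Hom_def)

text \<open>Continuity of \<open>\<tau>\<close> on the product topology lets it be applied to any finite family of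
  continuous maps with a common source: the interval for paths, the square for homotopies.\<close>

lemma continuous_map_Op:
  assumes "topological_algebra T A X" "\<tau> \<in> Hom T n 1"
    and "\<And>i. i < n \<Longrightarrow> continuous_map Z X (h i)"
  shows "continuous_map Z X (\<lambda>z. Op A \<tau> (\<lambda>i\<in>{..<n}. h i z))"
proof -
  have "continuous_map Z (product_topology (\<lambda>_. X) {..<n}) (\<lambda>z. \<lambda>i\<in>{..<n}. h i z)"
    unfolding continuous_map_componentwise using assms(3) by auto
  moreover have "continuous_map (product_topology (\<lambda>_. X) {..<n}) X (Op A \<tau>)"
    using assms(1,2) unfolding topological_algebra_def by blast
  ultimately have "continuous_map Z X (Op A \<tau> \<circ> (\<lambda>z. \<lambda>i\<in>{..<n}. h i z))"
    by (rule continuous_map_compose)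
  then show ?thesis
    unfolding o_def .
qed

lemma pathin_path_op:
  assumes "topological_algebra T A X" "\<tau> \<in> Hom T n 1" "\<And>i. i < n \<Longrightarrow> pathin X (\<beta> i)"
  shows "pathin X (path_op T A \<tau> \<beta>)"
  using continuous_map_Op[OF assms(1,2), of unit_interval \<beta>] assms(3) HomD[OF assms(2)]
  by (simp add: pathin_def path_op_def)

lemma path_homotopic_path_op:
  assumes TA: "topological_algebra T A X" and \<tau>: "\<tau> \<in> Hom T n 1"
    and hom: "\<And>i. i < n \<Longrightarrow> path_homotopic X (\<beta> i) (\<gamma> i)"
  shows "path_homotopic X (path_op T A \<tau> \<beta>) (path_op T A \<tau> \<gamma>)"
proof -
  have "\<exists>h. continuous_map (prod_topology unit_interval unit_interval) X h \<and>
      (\<forall>s. h (0, s) = \<beta> i s) \<and> (\<forall>s. h (1, s) = \<gamma> i s) \<and>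
      (\<forall>t \<in> {0..1}. h (t, 0) = \<beta> i 0 \<and> h (t, 1) = \<beta> i 1)" if "i < n" for i
    using hom[OF that] by (rule path_homotopicE) blast
  then obtain h where h: "\<And>i. i < n \<Longrightarrow>
      continuous_map (prod_topology unit_interval unit_interval) X (h i) \<and>
      (\<forall>s. h i (0, s) = \<beta> i s) \<and> (\<forall>s. h i (1, s) = \<gamma> i s) \<and>
      (\<forall>t \<in> {0..1}. h i (t, 0) = \<beta> i 0 \<and> h i (t, 1) = \<beta> i 1)"
    by metis
  have "continuous_map (prod_topology unit_interval unit_interval) X
      (\<lambda>z. Op A \<tau> (\<lambda>i\<in>{..<n}. h i z))"
    using h by (intro continuous_map_Op[OF TA \<tau>]) blast
  then show ?thesis
    by (rule path_homotopicI)
       (use h HomD[OF \<tau>] in \<open>auto simp: path_op_def intro!: arg_cong[where f = "Op A \<tau>"]\<close>)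
qed

text \<open>Two choices of representatives are homotopic in each coordinate, and \<open>\<tau>\<close> preserves this, so
  the paths collected by the definition form a single class.\<close>

lemma Op_path_class_alg:
  assumes TA: "topological_algebra T A X" and \<tau>: "\<tau> \<in> Hom T n 1"
    and \<beta>: "\<And>i. i < n \<Longrightarrow> pathin X (\<beta> i)"
    and c: "\<And>i. i < n \<Longrightarrow> c i = path_class X (\<beta> i)"
  shows "Op (path_class_alg T A X) \<tau> c = path_class X (path_op T A \<tau> \<beta>)"
proof -
  have "(\<exists>\<gamma>. (\<forall>i<n. \<gamma> i \<in> c i) \<and> path_homotopic X (path_op T A \<tau> \<gamma>) r)
      \<longleftrightarrow> path_homotopic X (path_op T A \<tau> \<beta>) r" for r
  proof
    assume "\<exists>\<gamma>. (\<forall>i<n. \<gamma> i \<in> c i) \<and> path_homotopic X (path_op T A \<tau> \<gamma>) r"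
    then obtain \<gamma> where "\<And>i. i < n \<Longrightarrow> path_homotopic X (\<beta> i) (\<gamma> i)"
      and r: "path_homotopic X (path_op T A \<tau> \<gamma>) r"
      using c by (auto simp: path_class_def)
    then have "path_homotopic X (path_op T A \<tau> \<beta>) (path_op T A \<tau> \<gamma>)"
      by (intro path_homotopic_path_op[OF TA \<tau>])
    then show "path_homotopic X (path_op T A \<tau> \<beta>) r"
      using r by (rule path_homotopic_trans)
  next
    assume "path_homotopic X (path_op T A \<tau> \<beta>) r"
    then show "\<exists>\<gamma>. (\<forall>i<n. \<gamma> i \<in> c i) \<and> path_homotopic X (path_op T A \<tau> \<gamma>) r"
      using \<beta> c mem_path_class_self by blast
  qed
  then show ?thesis
    using HomD[OF \<tau>] by (simp add: path_class_alg_def path_class_def)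
qed

lemma Carrier_path_class_alg: "Carrier (path_class_alg T A X) = Arr (fundamental_groupoid X)"
  by (simp add: path_class_alg_def)

lemma tuple_of_path_classes:
  assumes "c \<in> {..<n} \<rightarrow>\<^sub>E Carrier (path_class_alg T A X)"
  shows "\<exists>\<beta>. \<forall>i<n. pathin X (\<beta> i) \<and> c i = path_class X (\<beta> i)"
proof -
  have "\<forall>i<n. \<exists>p. pathin X p \<and> c i = path_class X p"
    using assms unfolding Carrier_path_class_alg Arr_fundamental_groupoid by fastforce
  then show ?thesis by metis
qed

lemma path_point_tuple:
  assumes "topological_algebra T A X" "\<And>i. i < n \<Longrightarrow> pathin X (\<beta> i)" "s \<in> {0..1}"
  shows "(\<lambda>i\<in>{..<n}. \<beta> i s) \<in> {..<n} \<rightarrow>\<^sub>E Carrier A"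
proof -
  have "topspace X = Carrier A" using assms(1) by (simp add: topological_algebra_def)
  then have "\<beta> i s \<in> Carrier A" if "i < n" for i
    using pathin_in_topspace[OF assms(2)[OF that] assms(3)] by simp
  then show ?thesis by auto
qed

text \<open>The equations of the theory pass from points to paths, since \<open>\<tau>\<close> acts pointwise in the
  parameter, and from paths to classes.  For parameters outside \<open>{0..1}\<close> a path may leave \<open>A\<close>
  and the equations may fail, so they are obtained as homotopies and not as equalities of
  functions.\<close>

lemma theory_algebra_path_class_alg:
  assumes TA: "topological_algebra T A X"
  shows "theory_algebra T (path_class_alg T A X)"
proof -
  interpret A: theory_algebra T A
    using TA by (simp add: topological_algebra_def)
  show ?thesis
  proof
    fix \<tau> n c
    assume \<tau>: "\<tau> \<in> Hom T n 1" and c: "c \<in> {..<n} \<rightarrow>\<^sub>E Carrier (path_class_alg T A X)"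
    obtain \<beta> where \<beta>: "\<And>i. i < n \<Longrightarrow> pathin X (\<beta> i)" "\<And>i. i < n \<Longrightarrow> c i = path_class X (\<beta> i)"
      using tuple_of_path_classes[OF c] by blast
    have "Op (path_class_alg T A X) \<tau> c = path_class X (path_op T A \<tau> \<beta>)"
      by (rule Op_path_class_alg[OF TA \<tau> \<beta>])
    moreover have "pathin X (path_op T A \<tau> \<beta>)"
      by (rule pathin_path_op[OF TA \<tau> \<beta>(1)])
    ultimately show "Op (path_class_alg T A X) \<tau> c \<in> Carrier (path_class_alg T A X)"
      unfolding Carrier_path_class_alg Arr_fundamental_groupoid by blast
  next
    fix i n :: nat and c
    assume i: "i < n" and c: "c \<in> {..<n} \<rightarrow>\<^sub>E Carrier (path_class_alg T A X)"
    obtain \<beta> where \<beta>: "\<And>i. i < n \<Longrightarrow> pathin X (\<beta> i)" "\<And>i. i < n \<Longrightarrow> c i = path_class X (\<beta> i)"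
      using tuple_of_path_classes[OF c] by blast
    note Pr = A.Proj_in[OF i]
    have "path_op T A (Proj T n i) \<beta> s = \<beta> i s" if "s \<in> {0..1}" for s
      using A.Op_Proj[OF i path_point_tuple[OF TA \<beta>(1) that]] i HomD[OF Pr]
      by (simp add: path_op_def)
    then have "path_class X (path_op T A (Proj T n i) \<beta>) = path_class X (\<beta> i)"
      by (intro path_class_eq_on pathin_path_op[OF TA Pr] \<beta>(1))
    then show "Op (path_class_alg T A X) (Proj T n i) c = c i"
      using Op_path_class_alg[OF TA Pr \<beta>] \<beta>(2)[OF i] by simp
  next
    fix f m n \<tau> c
    assume f: "f \<in> Hom T m n" and \<tau>: "\<tau> \<in> Hom T n 1"
      and c: "c \<in> {..<m} \<rightarrow>\<^sub>E Carrier (path_class_alg T A X)"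
    obtain \<beta> where \<beta>: "\<And>i. i < m \<Longrightarrow> pathin X (\<beta> i)" "\<And>i. i < m \<Longrightarrow> c i = path_class X (\<beta> i)"
      using tuple_of_path_classes[OF c] by blast
    have f\<tau>: "f \<Zsemi>\<^bsub>T\<^esub> \<tau> \<in> Hom T m 1"
      using f \<tau> by (rule A.Comp_in)
    have fi: "f \<Zsemi>\<^bsub>T\<^esub> Proj T n i \<in> Hom T m 1" if "i < n" for i
      using f A.Proj_in[OF that] by (rule A.Comp_in)
    let ?\<gamma> = "\<lambda>i. path_op T A (f \<Zsemi>\<^bsub>T\<^esub> Proj T n i) \<beta>"
    have "path_op T A (f \<Zsemi>\<^bsub>T\<^esub> \<tau>) \<beta> s = path_op T A \<tau> ?\<gamma> s" if "s \<in> {0..1}" for s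
    proof -
      have "(\<lambda>i\<in>{..<n}. Op A (f \<Zsemi>\<^bsub>T\<^esub> Proj T n i) (\<lambda>i\<in>{..<m}. \<beta> i s)) = (\<lambda>i\<in>{..<n}. ?\<gamma> i s)"
        using HomD(2)[OF fi] by (intro restrict_ext) (simp add: path_op_def)
      then show ?thesis
        using A.Op_Comp[OF f \<tau> path_point_tuple[OF TA \<beta>(1) that]]
        by (simp add: path_op_def[of T A "f \<Zsemi>\<^bsub>T\<^esub> \<tau>"] path_op_def[of T A \<tau>]
            HomD(2)[OF f\<tau>] HomD(2)[OF \<tau>])
    qed
    then have "path_class X (path_op T A (f \<Zsemi>\<^bsub>T\<^esub> \<tau>) \<beta>) = path_class X (path_op T A \<tau> ?\<gamma>)"
      by (intro path_class_eq_on pathin_path_op[OF TA f\<tau>] \<beta>(1))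
    moreover have "Op (path_class_alg T A X) (f \<Zsemi>\<^bsub>T\<^esub> \<tau>) c = path_class X (path_op T A (f \<Zsemi>\<^bsub>T\<^esub> \<tau>) \<beta>)"
      by (rule Op_path_class_alg[OF TA f\<tau> \<beta>])
    moreover have "Op (path_class_alg T A X) \<tau>
        (\<lambda>i\<in>{..<n}. Op (path_class_alg T A X) (f \<Zsemi>\<^bsub>T\<^esub> Proj T n i) c)
        = path_class X (path_op T A \<tau> ?\<gamma>)"
    proof (rule Op_path_class_alg[OF TA \<tau>])
      show "pathin X (?\<gamma> i)" if "i < n" for i
        by (rule pathin_path_op[OF TA fi[OF that] \<beta>(1)])
      show "(\<lambda>i\<in>{..<n}. Op (path_class_alg T A X) (f \<Zsemi>\<^bsub>T\<^esub> Proj T n i) c) i = path_class X (?\<gamma> i)"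
        if "i < n" for i
        using that Op_path_class_alg[OF TA fi[OF that] \<beta>] by simp
    qed
    ultimately show "Op (path_class_alg T A X) (f \<Zsemi>\<^bsub>T\<^esub> \<tau>) c = Op (path_class_alg T A X) \<tau>
        (\<lambda>i\<in>{..<n}. Op (path_class_alg T A X) (f \<Zsemi>\<^bsub>T\<^esub> Proj T n i) c)"
      by simp
  qed
qed


section \<open>The structure maps are homomorphisms\<close>

text \<open>The composable pairs form the pullback of target and source, so they are closed under the
  operations because target and source are homomorphisms.\<close>

lemma theory_algebra_composable_alg:
  assumes M: "theory_algebra T M" and Carrier_M: "Carrier M = Arr G"
    and Dom_hom: "alg_hom T M A (Dom G)" and Cod_hom: "alg_hom T M A (Cod G)"
  shows "theory_algebra T (composable_alg T G M)"
proof -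
  interpret M: theory_algebra T M by fact
  let ?P = "composable_alg T G M"
  let ?fst = "\<lambda>n x. \<lambda>i\<in>{..<n}. fst (x i)" and ?snd = "\<lambda>n x. \<lambda>i\<in>{..<n}. snd (x i)"
  have component: "fst (x i) \<in> Carrier M \<and> snd (x i) \<in> Carrier M
      \<and> Cod G (fst (x i)) = Dom G (snd (x i))"
    if "x \<in> {..<n} \<rightarrow>\<^sub>E Carrier ?P" "i < n" for x n i
  proof -
    have "x i \<in> Carrier ?P"
      using that by (intro PiE_mem[of x "{..<n}"]) auto
    then show ?thesis by (auto simp: composable_alg_def Carrier_M)
  qed
  have components: "?fst n x \<in> {..<n} \<rightarrow>\<^sub>E Carrier M" "?snd n x \<in> {..<n} \<rightarrow>\<^sub>E Carrier M"
    "\<And>i. i < n \<Longrightarrow> Cod G (fst (x i)) = Dom G (snd (x i))"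
    if "x \<in> {..<n} \<rightarrow>\<^sub>E Carrier ?P" for x n
    using component[OF that] by auto
  have Op_P: "Op ?P \<tau> x = (Op M \<tau> (?fst n x), Op M \<tau> (?snd n x))" if "\<tau> \<in> Hom T n 1" for \<tau> n x
    using HomD[OF that] by (simp add: composable_alg_def)
  show ?thesis
  proof
    fix \<tau> n x
    assume \<tau>: "\<tau> \<in> Hom T n 1" and x: "x \<in> {..<n} \<rightarrow>\<^sub>E Carrier ?P"
    note xs = components[OF x]
    have "Cod G (Op M \<tau> (?fst n x)) = Op A \<tau> (\<lambda>i\<in>{..<n}. Cod G (?fst n x i))"
      using Cod_hom \<tau> xs(1) unfolding alg_hom_def by blast
    moreover have "Dom G (Op M \<tau> (?snd n x)) = Op A \<tau> (\<lambda>i\<in>{..<n}. Dom G (?snd n x i))"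
      using Dom_hom \<tau> xs(2) unfolding alg_hom_def by blast
    moreover have "(\<lambda>i\<in>{..<n}. Cod G (?fst n x i)) = (\<lambda>i\<in>{..<n}. Dom G (?snd n x i))"
      using xs(3) by (intro restrict_ext) simp
    ultimately have "Cod G (Op M \<tau> (?fst n x)) = Dom G (Op M \<tau> (?snd n x))"
      by (simp only:)
    moreover have "Op M \<tau> (?fst n x) \<in> Arr G" "Op M \<tau> (?snd n x) \<in> Arr G"
      using M.Op_in[OF \<tau> xs(1)] M.Op_in[OF \<tau> xs(2)] by (simp_all only: Carrier_M)
    moreover have "(g, h) \<in> Carrier ?P \<longleftrightarrow> g \<in> Arr G \<and> h \<in> Arr G \<and> Cod G g = Dom G h" for g h
      by (simp add: composable_alg_def)
    ultimately show "Op ?P \<tau> x \<in> Carrier ?P"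
      unfolding Op_P[OF \<tau>] by blast
  next
    fix i n :: nat and x
    assume i: "i < n" and x: "x \<in> {..<n} \<rightarrow>\<^sub>E Carrier ?P"
    show "Op ?P (Proj T n i) x = x i"
      unfolding Op_P[OF M.Proj_in[OF i]]
      using M.Op_Proj[OF i components(1)[OF x]] M.Op_Proj[OF i components(2)[OF x]] i by simp
  next
    fix f m n \<tau> x
    assume f: "f \<in> Hom T m n" and \<tau>: "\<tau> \<in> Hom T n 1" and x: "x \<in> {..<m} \<rightarrow>\<^sub>E Carrier ?P"
    note xs = components[OF x]
    have fi: "f \<Zsemi>\<^bsub>T\<^esub> Proj T n i \<in> Hom T m 1" if "i < n" for i
      using f M.Proj_in[OF that] by (rule M.Comp_in)
    let ?y = "\<lambda>i\<in>{..<n}. Op ?P (f \<Zsemi>\<^bsub>T\<^esub> Proj T n i) x"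
    have "?fst n ?y = (\<lambda>i\<in>{..<n}. Op M (f \<Zsemi>\<^bsub>T\<^esub> Proj T n i) (?fst m x))"
      and "?snd n ?y = (\<lambda>i\<in>{..<n}. Op M (f \<Zsemi>\<^bsub>T\<^esub> Proj T n i) (?snd m x))"
      using Op_P[OF fi] by (auto intro!: restrict_ext)
    then show "Op ?P (f \<Zsemi>\<^bsub>T\<^esub> \<tau>) x = Op ?P \<tau> ?y"
      unfolding Op_P[OF \<tau>] Op_P[OF M.Comp_in[OF f \<tau>]]
      by (simp only: M.Op_Comp[OF f \<tau> xs(1)] M.Op_Comp[OF f \<tau> xs(2)])
  qed
qed

lemma alg_hom_Dom_Cod_fundamental_groupoid:
  assumes TA: "topological_algebra T A X"
  shows "alg_hom T (path_class_alg T A X) A (Dom (fundamental_groupoid X))" (is ?Dom)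
    and "alg_hom T (path_class_alg T A X) A (Cod (fundamental_groupoid X))" (is ?Cod)
proof -
  have top: "topspace X = Carrier A"
    using TA by (simp add: topological_algebra_def)
  have "Dom (fundamental_groupoid X) (Op (path_class_alg T A X) \<tau> c)
      = Op A \<tau> (\<lambda>i\<in>{..<n}. Dom (fundamental_groupoid X) (c i))
    \<and> Cod (fundamental_groupoid X) (Op (path_class_alg T A X) \<tau> c)
      = Op A \<tau> (\<lambda>i\<in>{..<n}. Cod (fundamental_groupoid X) (c i))"
    if \<tau>: "\<tau> \<in> Hom T n 1" and c: "c \<in> {..<n} \<rightarrow>\<^sub>E Carrier (path_class_alg T A X)" for \<tau> n c
  proof -
    obtain \<beta> where \<beta>: "\<And>i. i < n \<Longrightarrow> pathin X (\<beta> i)" "\<And>i. i < n \<Longrightarrow> c i = path_class X (\<beta> i)"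
      using tuple_of_path_classes[OF c] by blast
    have "(\<lambda>i\<in>{..<n}. Dom (fundamental_groupoid X) (c i)) = (\<lambda>i\<in>{..<n}. \<beta> i 0)"
      "(\<lambda>i\<in>{..<n}. Cod (fundamental_groupoid X) (c i)) = (\<lambda>i\<in>{..<n}. \<beta> i 1)"
      using \<beta> by (auto intro!: restrict_ext simp: Dom_path_class Cod_path_class)
    then show ?thesis
      using pathin_path_op[OF TA \<tau> \<beta>(1)] HomD[OF \<tau>]
      by (simp add: Op_path_class_alg[OF TA \<tau> \<beta>] Dom_path_class Cod_path_class path_op_def)
  qed
  moreover have "Dom (fundamental_groupoid X) \<in> Carrier (path_class_alg T A X) \<rightarrow> Carrier A"
    "Cod (fundamental_groupoid X) \<in> Carrier (path_class_alg T A X) \<rightarrow> Carrier A"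
    using pathin_ends
    by (auto simp: Carrier_path_class_alg Arr_fundamental_groupoid Dom_path_class Cod_path_class
        top[symmetric])
  ultimately show ?Dom ?Cod by (simp_all add: alg_hom_def)
qed

lemma alg_hom_Ident_fundamental_groupoid:
  assumes TA: "topological_algebra T A X"
  shows "alg_hom T A (path_class_alg T A X) (Ident (fundamental_groupoid X))"
  unfolding alg_hom_def
proof (intro conjI allI ballI)
  have top: "topspace X = Carrier A"
    using TA by (simp add: topological_algebra_def)
  then have const: "pathin X (\<lambda>_. a)" if "a \<in> Carrier A" for a
    using that by simp
  show "Ident (fundamental_groupoid X) \<in> Carrier A \<rightarrow> Carrier (path_class_alg T A X)"
    using const by (auto simp: Carrier_path_class_alg Arr_fundamental_groupoid
        Ident_fundamental_groupoid)
  fix n \<tau> x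
  assume \<tau>: "\<tau> \<in> Hom T n 1" and x: "x \<in> {..<n} \<rightarrow>\<^sub>E Carrier A"
  have "path_op T A \<tau> (\<lambda>i _. x i) = (\<lambda>_. Op A \<tau> x)"
    using HomD[OF \<tau>] x by (simp add: path_op_def PiE_restrict)
  then have "Ident (fundamental_groupoid X) (Op A \<tau> x) = path_class X (path_op T A \<tau> (\<lambda>i _. x i))"
    by (simp add: Ident_fundamental_groupoid)
  also have "\<dots> = Op (path_class_alg T A X) \<tau> (\<lambda>i\<in>{..<n}. Ident (fundamental_groupoid X) (x i))"
    using const x by (intro Op_path_class_alg[OF TA \<tau>, symmetric])
      (auto simp: Ident_fundamental_groupoid PiE_iff)
  finally show "Ident (fundamental_groupoid X) (Op A \<tau> x)
      = Op (path_class_alg T A X) \<tau> (\<lambda>i\<in>{..<n}. Ident (fundamental_groupoid X) (x i))" .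
qed

lemma path_op_concat:
  "path_op T A \<tau> (\<lambda>i. path_concat (\<beta> i) (\<gamma> i))
     = path_concat (path_op T A \<tau> \<beta>) (path_op T A \<tau> \<gamma>)"
  by (auto simp: path_op_def path_concat_def fun_eq_iff)

lemma alg_hom_Comp_fundamental_groupoid:
  assumes TA: "topological_algebra T A X"
  shows "alg_hom T (composable_alg T (fundamental_groupoid X) (path_class_alg T A X))
           (path_class_alg T A X) (\<lambda>(g, h). g \<Zsemi>\<^bsub>fundamental_groupoid X\<^esub> h)"
  unfolding alg_hom_def
proof (intro conjI allI ballI)
  let ?G = "fundamental_groupoid X" and ?M = "path_class_alg T A X"
  let ?P = "composable_alg T ?G ?M"
  have pair: "\<exists>p q. pathin X p \<and> pathin X q \<and> p 1 = q 0 \<and> z = (path_class X p, path_class X q)"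
    if "z \<in> Carrier ?P" for z
    using that by (auto simp: composable_alg_def Arr_fundamental_groupoid
        Dom_path_class Cod_path_class) metis
  show "(\<lambda>(g, h). g \<Zsemi>\<^bsub>?G\<^esub> h) \<in> Carrier ?P \<rightarrow> Carrier ?M"
  proof
    fix z assume "z \<in> Carrier ?P"
    then obtain p q where pq: "pathin X p" "pathin X q" "p 1 = q 0"
      "z = (path_class X p, path_class X q)"
      using pair by blast
    then show "(\<lambda>(g, h). g \<Zsemi>\<^bsub>?G\<^esub> h) z \<in> Carrier ?M"
      using pathin_concat[OF pq(1-3)]
      by (auto simp: Carrier_path_class_alg Arr_fundamental_groupoid Comp_path_class)
  qed
  fix n \<tau> z
  assume \<tau>: "\<tau> \<in> Hom T n 1" and z: "z \<in> {..<n} \<rightarrow>\<^sub>E Carrier ?P"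
  have "\<forall>i\<in>{..<n}. \<exists>p q. pathin X p \<and> pathin X q \<and> p 1 = q 0
      \<and> z i = (path_class X p, path_class X q)"
    using pair z by (auto simp: PiE_iff)
  then obtain \<beta> \<gamma> where \<beta>\<gamma>: "\<forall>i\<in>{..<n}. pathin X (\<beta> i) \<and> pathin X (\<gamma> i) \<and> \<beta> i 1 = \<gamma> i 0
      \<and> z i = (path_class X (\<beta> i), path_class X (\<gamma> i))"
    by metis
  have junction: "path_op T A \<tau> \<beta> 1 = path_op T A \<tau> \<gamma> 0"
    using \<beta>\<gamma> HomD[OF \<tau>] by (auto simp: path_op_def intro!: arg_cong[where f = "Op A \<tau>"])
  have paths: "pathin X (path_op T A \<tau> \<beta>)" "pathin X (path_op T A \<tau> \<gamma>)"
    using \<beta>\<gamma> by (auto intro: pathin_path_op[OF TA \<tau>])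
  have "Op ?P \<tau> z = (path_class X (path_op T A \<tau> \<beta>), path_class X (path_op T A \<tau> \<gamma>))"
    using HomD[OF \<tau>] \<beta>\<gamma> by (simp add: composable_alg_def Op_path_class_alg[OF TA \<tau>])
  then have "(\<lambda>(g, h). g \<Zsemi>\<^bsub>?G\<^esub> h) (Op ?P \<tau> z)
      = path_class X (path_concat (path_op T A \<tau> \<beta>) (path_op T A \<tau> \<gamma>))"
    using Comp_path_class[OF paths junction] by simp
  also have "\<dots> = path_class X (path_op T A \<tau> (\<lambda>i. path_concat (\<beta> i) (\<gamma> i)))"
    by (simp add: path_op_concat)
  also have "\<dots> = Op ?M \<tau> (\<lambda>i\<in>{..<n}. (\<lambda>(g, h). g \<Zsemi>\<^bsub>?G\<^esub> h) (z i))"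
    using \<beta>\<gamma> by (intro Op_path_class_alg[OF TA \<tau>, symmetric])
      (auto simp: pathin_concat Comp_path_class)
  finally show "(\<lambda>(g, h). g \<Zsemi>\<^bsub>?G\<^esub> h) (Op ?P \<tau> z)
      = Op ?M \<tau> (\<lambda>i\<in>{..<n}. (\<lambda>(g, h). g \<Zsemi>\<^bsub>?G\<^esub> h) (z i))" .
qed

lemma alg_hom_Inv_fundamental_groupoid:
  assumes TA: "topological_algebra T A X"
  shows "alg_hom T (path_class_alg T A X) (path_class_alg T A X) (Inv (fundamental_groupoid X))"
  unfolding alg_hom_def
proof (intro conjI allI ballI)
  let ?G = "fundamental_groupoid X" and ?M = "path_class_alg T A X"
  show "Inv ?G \<in> Carrier ?M \<rightarrow> Carrier ?M"
    using pathin_reverse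
    by (fastforce simp: Carrier_path_class_alg Arr_fundamental_groupoid Inv_path_class)
  fix n \<tau> c
  assume \<tau>: "\<tau> \<in> Hom T n 1" and c: "c \<in> {..<n} \<rightarrow>\<^sub>E Carrier ?M"
  obtain \<beta> where \<beta>: "\<And>i. i < n \<Longrightarrow> pathin X (\<beta> i)" "\<And>i. i < n \<Longrightarrow> c i = path_class X (\<beta> i)"
    using tuple_of_path_classes[OF c] by blast
  have "Inv ?G (Op ?M \<tau> c) = path_class X (\<lambda>t. path_op T A \<tau> \<beta> (1 - t))"
    using pathin_path_op[OF TA \<tau> \<beta>(1)] by (simp add: Op_path_class_alg[OF TA \<tau> \<beta>] Inv_path_class)
  also have "\<dots> = path_class X (path_op T A \<tau> (\<lambda>i t. \<beta> i (1 - t)))"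
    by (simp add: path_op_def)
  also have "\<dots> = Op ?M \<tau> (\<lambda>i\<in>{..<n}. Inv ?G (c i))"
    using \<beta> by (intro Op_path_class_alg[OF TA \<tau>, symmetric])
      (auto simp: pathin_reverse Inv_path_class)
  finally show "Inv ?G (Op ?M \<tau> c) = Op ?M \<tau> (\<lambda>i\<in>{..<n}. Inv ?G (c i))" .
qed

theorem theorem4p5:
  fixes T :: "'o lawvere"
    and A :: "('o, 'a) alg"
    and X :: "'a topology"
  assumes "semi_abelian_theory T"
    and "topological_algebra T A X"
  shows "(\<forall>n. \<forall>\<tau> \<in> Hom T n 1. \<forall>\<beta>. (\<forall>i<n. pathin X (\<beta> i)) \<longrightarrow>
            Op (path_class_alg T A X) \<tau> (\<lambda>i\<in>{..<n}. path_class X (\<beta> i))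
              = path_class X (path_op T A \<tau> \<beta>))
         \<and> internal_groupoid T A (path_class_alg T A X) (fundamental_groupoid X)"
proof (intro conjI allI ballI impI)
  note TA = assms(2)
  show "Op (path_class_alg T A X) \<tau> (\<lambda>i\<in>{..<n}. path_class X (\<beta> i))
      = path_class X (path_op T A \<tau> \<beta>)"
    if "\<tau> \<in> Hom T n 1" "\<forall>i<n. pathin X (\<beta> i)" for n \<tau> \<beta>
    using that by (intro Op_path_class_alg[OF TA]) auto
  have "theory_algebra T A" "Carrier A = Obj (fundamental_groupoid X)"
    using TA by (auto simp: topological_algebra_def Obj_fundamental_groupoid)
  then show "internal_groupoid T A (path_class_alg T A X) (fundamental_groupoid X)"
    unfolding internal_groupoid_def
    using TA
    by (intro conjI groupoid_fundamental_groupoid theory_algebra_path_class_alg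
        Carrier_path_class_alg alg_hom_Dom_Cod_fundamental_groupoid
        alg_hom_Ident_fundamental_groupoid alg_hom_Comp_fundamental_groupoid
        alg_hom_Inv_fundamental_groupoid theory_algebra_composable_alg[where A = A])
qed

end
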